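(* Let $(G,P,p,\theta)$ be a social network and let $top \in P$ be a product. Let $[top]$ denote the constant function assigning $\{top\}$ to every node of $G$. Then the social network $(G,P,[top],\theta)$ is reachable from $(G,P,p,\theta)$ if and only if both of the following hold: (1) for all nodes $i$, $top \in p(i)$; (2) the weighted directed graph $G_{p,top}$ is $\theta$-well-structured.
   Context: Setting. $G=(V,E)$ is a finite weighted directed graph with no parallel edges and no self-loops, $n=|V|$, and each edge $(i,j)$ has a weight $w_{ij}\in[0,1]$. For a node $i$, $N(i)$ is the set of nodes $j$ with an edge $(j,i)\in E$ (the neighbours of $i$). It is assumed that $\sum_{j\in N(i)} w_{ji}\le 1$ for every node $i$ with $N(i)\ne\emptyset$. The threshold function $\theta$ assigns to each node $i$ a value $\theta(i)\in(0,1]$. $P$ is a finite set of products. A social network is a tuple $(G,P,p,\theta)$ where $p$ assigns to each node a non-empty subset of $P$; since $G,P,\theta$ are fixed, a social network is identified with $p$. Reductions. For a product $t$ and a node $i$, the adoption condition $A(t,i)$ holds in $p$ if $N(i)=\emptyset$, or if $N(i)\neq\emptyset$ and $\sum_{j\in N(i)\mid p(j)=\{t\}} w_{ji}\ge\theta(i)$. Write $p_1\to p_2$ if $p_2\ne p_1$ and for all nodes $i$ with $p_2(i)\ne p_1(i)$ we have $|p_1(i)|\ge 2$ and, for some $t\in p_1(i)$, $p_2(i)=\{t\}$ and $A(t,i)$ holds in $p_1$. Let $\to^*$ be the reflexive, transitive closure of $\to$. A network $p'$ is reachable from $p$ if $p\to^* p'$. The graph $G_{p,t}$ is obtained from $G$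 by removing all edges into nodes $i$ with $p(i)=\{t\}$ (so such nodes have no neighbours in $G_{p,t}$, and all other nodes have the same neighbours as in $G$, with the same weights). A weighted directed graph is $\theta$-well-structured if there is a function $level$ from its nodes to the natural numbers such that for every node $i$ with $N(i)\ne\emptyset$ (neighbours taken in that graph), $\sum_{j\in N(i)\mid level(j)<level(i)} w_{ji}\ge\theta(i)$. *)

theory Defs
  imports Complex_Main "HOL-Library.FuncSet" "Graph_Theory.Pair_Digraph"
begin

text \<open>
  An edge \<open>(j, i)\<close> of a pair digraph points from \<open>j\<close> to \<open>i\<close>; its weight is \<open>w (j, i)\<close>.
  Neighbours are in-neighbours.
\<close>

definition neighbours :: "'a pair_pre_digraph \<Rightarrow> 'a \<Rightarrow> 'a set" where
  "neighbours G i = {j. (j, i) \<in> parcs G}"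

locale weighted_pair_digraph = pair_digraph G
  for G :: "'a pair_pre_digraph" +
  fixes w :: "'a \<times> 'a \<Rightarrow> real"
  assumes weight_bounds: "e \<in> parcs G \<Longrightarrow> 0 \<le> w e \<and> w e \<le> 1"
    and weight_sum_le_1:
      "i \<in> pverts G \<Longrightarrow> neighbours G i \<noteq> {} \<Longrightarrow> (\<Sum>j\<in>neighbours G i. w (j, i)) \<le> 1"

locale product_adoption = weighted_pair_digraph G w
  for G :: "'a pair_pre_digraph" and w :: "'a \<times> 'a \<Rightarrow> real" +
  fixes P :: "'b set" and \<theta> :: "'a \<Rightarrow> real"
  assumes finite_products: "finite P"
    and threshold_bounds: "i \<in> pverts G \<Longrightarrow> 0 < \<theta> i \<and> \<theta> i \<le> 1"

text \<open>
  For fixed \<open>G\<close>, \<open>P\<close>, \<open>\<theta>\<close>, a social network is identified with its product assignment.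
  Assignments are extensional, so that equality of assignments is equality on the nodes of \<open>G\<close>.
\<close>

definition social_networks :: "'a pair_pre_digraph \<Rightarrow> 'b set \<Rightarrow> ('a \<Rightarrow> 'b set) set" where
  "social_networks G P = (\<Pi>\<^sub>E i\<in>pverts G. {S. S \<subseteq> P \<and> S \<noteq> {}})"

definition const_network :: "'a pair_pre_digraph \<Rightarrow> 'b \<Rightarrow> ('a \<Rightarrow> 'b set)" where
  "const_network G t = (\<lambda>i\<in>pverts G. {t})"

definition adoption_condition ::
  "'a pair_pre_digraph \<Rightarrow> ('a \<times> 'a \<Rightarrow> real) \<Rightarrow> ('a \<Rightarrow> real) \<Rightarrow> ('a \<Rightarrow> 'b set) \<Rightarrow> 'b \<Rightarrow> 'a \<Rightarrow> bool" where
  "adoption_condition G w \<theta> p t i \<longleftrightarrow>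
     neighbours G i = {} \<or>
     neighbours G i \<noteq> {} \<and> (\<Sum>j\<in>{j \<in> neighbours G i. p j = {t}}. w (j, i)) \<ge> \<theta> i"

definition reduces ::
  "'a pair_pre_digraph \<Rightarrow> ('a \<times> 'a \<Rightarrow> real) \<Rightarrow> 'b set \<Rightarrow> ('a \<Rightarrow> real)
     \<Rightarrow> ('a \<Rightarrow> 'b set) \<Rightarrow> ('a \<Rightarrow> 'b set) \<Rightarrow> bool" where
  "reduces G w P \<theta> p1 p2 \<longleftrightarrow>
     p1 \<in> social_networks G P \<and> p2 \<in> social_networks G P \<and> p2 \<noteq> p1 \<and>
     (\<forall>i\<in>pverts G. p2 i \<noteq> p1 i \<longrightarrow>
        card (p1 i) \<ge> 2 \<and> (\<exists>t\<in>p1 i. p2 i = {t} \<and> adoption_condition G w \<theta> p1 t i))"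

definition network_reachable ::
  "'a pair_pre_digraph \<Rightarrow> ('a \<times> 'a \<Rightarrow> real) \<Rightarrow> 'b set \<Rightarrow> ('a \<Rightarrow> real)
     \<Rightarrow> ('a \<Rightarrow> 'b set) \<Rightarrow> ('a \<Rightarrow> 'b set) \<Rightarrow> bool" where
  "network_reachable G w P \<theta> = (reduces G w P \<theta>)\<^sup>*\<^sup>*"

text \<open>The weights of \<open>cut_graph G p t\<close> are those of \<open>G\<close> on the remaining edges.\<close>

definition cut_graph ::
  "'a pair_pre_digraph \<Rightarrow> ('a \<Rightarrow> 'b set) \<Rightarrow> 'b \<Rightarrow> 'a pair_pre_digraph" where
  "cut_graph G p t = \<lparr>pverts = pverts G, parcs = {(j, i) \<in> parcs G. p i \<noteq> {t}}\<rparr>"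

definition well_structured ::
  "'a pair_pre_digraph \<Rightarrow> ('a \<times> 'a \<Rightarrow> real) \<Rightarrow> ('a \<Rightarrow> real) \<Rightarrow> bool" where
  "well_structured G w \<theta> \<longleftrightarrow>
     (\<exists>level :: 'a \<Rightarrow> nat. \<forall>i\<in>pverts G. neighbours G i \<noteq> {} \<longrightarrow>
        (\<Sum>j\<in>{j \<in> neighbours G i. level j < level i}. w (j, i)) \<ge> \<theta> i)"

end

theory Submission
  imports Defs
begin

text \<open>
  Both directions follow a reduction sequence one step at a time. If \<open>p1\<close> reduces to \<open>p2\<close>, then
  a level function for the graph cut at \<open>p2\<close> becomes one for the graph cut at \<open>p1\<close> by shifting
  it up by one and putting the nodes that have already adopted \<open>t\<close> in \<open>p1\<close> on level \<open>0\<close>.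
  Conversely, given a level function, a node of minimal level among those that have not yet adopted
  \<open>t\<close> may adopt it, since all its neighbours of smaller level have done so; the same level
  function works for the resulting network.
\<close>

lemma neighbours_cut_graph:
  "neighbours (cut_graph G p t) i = (if p i = {t} then {} else neighbours G i)"
  by (auto simp: neighbours_def cut_graph_def)

lemma pverts_cut_graph [simp]: "pverts (cut_graph G p t) = pverts G"
  by (simp add: cut_graph_def)

text \<open>Nodes holding \<open>{t}\<close> lose all in-edges in the cut graph and so impose no
  condition; the others keep their neighbours. Well-structuredness for different networks thus
  concerns sums in the same graph \<open>G\<close>.\<close>

lemma well_structured_cut_graph_iff:
  "well_structured (cut_graph G p t) w \<theta> \<longleftrightarrow>
    (\<exists>level :: 'a \<Rightarrow> nat. \<forall>i\<in>pverts G. p i \<noteq> {t} \<longrightarrow> neighbours G i \<noteq> {} \<longrightarrow>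
      \<theta> i \<le> (\<Sum>j\<in>{j \<in> neighbours G i. level j < level i}. w (j, i)))"
  for G :: "'a pair_pre_digraph"
  unfolding well_structured_def pverts_cut_graph neighbours_cut_graph
  by (intro iff_exI ball_cong refl) simp

context product_adoption
begin

lemma neighbours_subset_pverts: "neighbours G i \<subseteq> pverts G"
  by (auto simp: neighbours_def intro: in_arcsD1)

lemma finite_neighbours: "finite (neighbours G i)"
  using neighbours_subset_pverts pair_finite_verts by (rule finite_subset)

text \<open>Weights are nonnegative, so each threshold estimate below comes down to an inclusion of
  index sets.\<close>

lemma weight_sum_mono:
  assumes "A \<subseteq> B" "B \<subseteq> neighbours G i"
  shows "(\<Sum>j\<in>A. w (j, i)) \<le> (\<Sum>j\<in>B. w (j, i))"
proof (rule sum_mono2)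
  show "finite B"
    using assms(2) finite_neighbours by (rule finite_subset)
  show "0 \<le> w (j, i)" if "j \<in> B - A" for j
    using that assms(2) weight_bounds by (auto simp: neighbours_def)
qed (fact assms(1))

text \<open>A node that changes picks a member of its own set, so product sets only shrink along
  reductions.\<close>

lemma reduces_mem_backwards:
  assumes "reduces G w P \<theta> p1 p2" "i \<in> pverts G" "t \<in> p2 i"
  shows "t \<in> p1 i"
proof (cases "p2 i = p1 i")
  case False
  then obtain s where "s \<in> p1 i" "p2 i = {s}"
    using assms(1,2) unfolding reduces_def by blast
  with assms(3) show ?thesis by simp
qed (use assms(3) in simp)

lemma reduces_well_structured_backwards:
  assumes red: "reduces G w P \<theta> p1 p2"
    and ws: "well_structured (cut_graph G p2 t) w \<theta>"
  shows "well_structured (cut_graph G p1 t) w \<theta>"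
proof -
  obtain level :: "'a \<Rightarrow> nat" where level:
    "\<And>i. i \<in> pverts G \<Longrightarrow> p2 i \<noteq> {t} \<Longrightarrow> neighbours G i \<noteq> {} \<Longrightarrow>
      \<theta> i \<le> (\<Sum>j\<in>{j \<in> neighbours G i. level j < level i}. w (j, i))"
    using ws unfolding well_structured_cut_graph_iff by blast
  \<comment> \<open>The \<open>Suc\<close> reserves level 0 for the nodes holding \<open>{t}\<close>
    in \<open>p1\<close>, strictly below all others.\<close>
  define level' where "level' i = (if p1 i = {t} then 0 else Suc (level i))" for i
  have "\<theta> i \<le> (\<Sum>j\<in>{j \<in> neighbours G i. level' j < level' i}. w (j, i))"
    if i: "i \<in> pverts G" "p1 i \<noteq> {t}" "neighbours G i \<noteq> {}" for i
  proof (cases "p2 i = {t}")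
    case True
    \<comment> \<open>Node \<open>i\<close> changes in this very step and ends with
      \<open>{t}\<close>, so the adoption condition for \<open>t\<close> held in
      \<open>p1\<close>.\<close>
    with red i have "\<theta> i \<le> (\<Sum>j\<in>{j \<in> neighbours G i. p1 j = {t}}. w (j, i))"
      unfolding reduces_def adoption_condition_def by fastforce
    also have "\<dots> \<le> (\<Sum>j\<in>{j \<in> neighbours G i. level' j < level' i}. w (j, i))"
      by (rule weight_sum_mono) (use i in \<open>auto simp: level'_def\<close>)
    finally show ?thesis .
  next
    case False
    with i level have "\<theta> i \<le> (\<Sum>j\<in>{j \<in> neighbours G i. level j < level i}. w (j, i))"
      by blast
    \<comment> \<open>A neighbour below \<open>i\<close> either drops to level 0 or is shifted along
      with \<open>i\<close>; both keep it below.\<close>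
    also have "\<dots> \<le> (\<Sum>j\<in>{j \<in> neighbours G i. level' j < level' i}. w (j, i))"
      by (rule weight_sum_mono) (use i in \<open>auto simp: level'_def\<close>)
    finally show ?thesis .
  qed
  then show ?thesis
    unfolding well_structured_cut_graph_iff by blast
qed

lemma network_reachable_const_imp:
  assumes "network_reachable G w P \<theta> p (const_network G t)"
  shows "(\<forall>i\<in>pverts G. t \<in> p i) \<and> well_structured (cut_graph G p t) w \<theta>"
  using assms unfolding network_reachable_def
proof (induction rule: converse_rtranclp_induct)
  case base
  \<comment> \<open>In the constant network every edge is cut, so any level function will
    do.\<close>
  show ?case
    by (simp add: well_structured_cut_graph_iff const_network_def)
next
  case (step p1 p2)
  then show ?case
    using reduces_mem_backwards reduces_well_structured_backwards by blast
qed

lemma minimal_level_reduces: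
  assumes p: "p \<in> social_networks G P"
    and t_in: "\<forall>i\<in>pverts G. t \<in> p i"
    and level: "\<forall>i\<in>pverts G. p i \<noteq> {t} \<longrightarrow> neighbours G i \<noteq> {} \<longrightarrow>
      \<theta> i \<le> (\<Sum>j\<in>{j \<in> neighbours G i. level j < (level i :: nat)}. w (j, i))"
    and i: "i \<in> pverts G" "p i \<noteq> {t}"
    and minimal: "\<And>j. j \<in> pverts G \<Longrightarrow> level j < level i \<Longrightarrow> p j = {t}"
  shows "reduces G w P \<theta> p (p(i := {t}))"
proof -
  have "adoption_condition G w \<theta> p t i"
  proof (cases "neighbours G i = {}")
    case False
    with i level have "\<theta> i \<le> (\<Sum>j\<in>{j \<in> neighbours G i. level j < level i}. w (j, i))"
      by blast
    also have "\<dots> \<le> (\<Sum>j\<in>{j \<in> neighbours G i. p j = {t}}. w (j, i))"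
      by (rule weight_sum_mono) (use minimal neighbours_subset_pverts in auto)
    finally show ?thesis
      using False by (simp add: adoption_condition_def)
  qed (simp add: adoption_condition_def)
  moreover have sub: "p i \<subseteq> P" and "t \<in> p i"
    using p t_in i by (auto simp: social_networks_def)
  \<comment> \<open>Finiteness of \<open>P\<close> matters here, as \<open>card\<close> is 0 on
    infinite sets.\<close>
  moreover have "2 \<le> card (p i)"
  proof -
    obtain s where "s \<in> p i" "s \<noteq> t"
      using i(2) \<open>t \<in> p i\<close> by blast
    then have "card {s, t} \<le> card (p i)"
      using \<open>t \<in> p i\<close> finite_subset[OF sub finite_products] by (intro card_mono) auto
    then show ?thesis
      using \<open>s \<noteq> t\<close> by simp
  qed
  moreover have "p(i := {t}) \<in> social_networks G P"
    using p i(1) sub \<open>t \<in> p i\<close> by (auto simp: social_networks_def PiE_iff extensional_def)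
  moreover have "p(i := {t}) \<noteq> p"
    using i(2) by (metis fun_upd_same)
  ultimately show ?thesis
    using p by (auto simp: reduces_def)
qed

text \<open>Each adoption lowers the number of nodes not holding \<open>{t}\<close>.
  \<open>level\<close> stays fixed in the induction: its condition concerns only such nodes, so an
  adoption merely removes constraints.\<close>

lemma network_reachable_const_if_level:
  assumes "p \<in> social_networks G P"
    and "\<forall>i\<in>pverts G. t \<in> p i"
    and "\<forall>i\<in>pverts G. p i \<noteq> {t} \<longrightarrow> neighbours G i \<noteq> {} \<longrightarrow>
      \<theta> i \<le> (\<Sum>j\<in>{j \<in> neighbours G i. level j < (level i :: nat)}. w (j, i))"
  shows "network_reachable G w P \<theta> p (const_network G t)"
  using assms
proof (induction "card {i \<in> pverts G. p i \<noteq> {t}}" arbitrary: p rule: less_induct)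
  case less
  let ?U = "{i \<in> pverts G. p i \<noteq> {t}}"
  show ?case
  proof (cases "?U = {}")
    case True
    \<comment> \<open>Agreement on the nodes gives equality because both assignments are
      extensional.\<close>
    with less.prems(1) have "p = const_network G t"
      by (auto simp: const_network_def social_networks_def PiE_iff extensional_def fun_eq_iff)
    then show ?thesis
      by (simp add: network_reachable_def)
  next
    case False
    then obtain i where i: "i \<in> ?U" and "\<forall>j. j \<in> ?U \<longrightarrow> level i \<le> level j"
      using ex_has_least_nat[of "\<lambda>i. i \<in> ?U" _ level] by blast
    then have "p j = {t}" if "j \<in> pverts G" "level j < level i" for j
      using that leD by blast
    with i less.prems have red: "reduces G w P \<theta> p (p(i := {t}))"
      by (intro minimal_level_reduces[where level = level]) auto
    have "{j \<in> pverts G. (p(i := {t})) j \<noteq> {t}} \<subset> ?U"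
      using i by auto
    then have "card {j \<in> pverts G. (p(i := {t})) j \<noteq> {t}} < card ?U"
      using pair_finite_verts by (intro psubset_card_mono) auto
    then have "network_reachable G w P \<theta> (p(i := {t})) (const_network G t)"
      using red less.prems by (intro less.hyps) (auto simp: reduces_def)
    with red show ?thesis
      unfolding network_reachable_def by (rule converse_rtranclp_into_rtranclp)
  qed
qed

end

theorem theorem1:
  fixes G :: "'a pair_pre_digraph" and w :: "'a \<times> 'a \<Rightarrow> real"
    and P :: "'b set" and \<theta> :: "'a \<Rightarrow> real"
    and p :: "'a \<Rightarrow> 'b set" and top :: 'b
  assumes "product_adoption G w P \<theta>"
    and "p \<in> social_networks G P"
    and "top \<in> P"
  shows "network_reachable G w P \<theta> p (const_network G top) \<longleftrightarrow>
    (\<forall>i\<in>pverts G. top \<in> p i) \<and> well_structured (cut_graph G p top) w \<theta>"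
proof -
  interpret product_adoption G w P \<theta>
    by (fact assms(1))
  show ?thesis
    using network_reachable_const_imp network_reachable_const_if_level[OF assms(2)]
    unfolding well_structured_cut_graph_iff by blast
qed

end
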